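(* Let $\Sigma=\{\veebar,\wedge,\vee,\mathbin{\dot\vee}\}$ and $n\geq 1$, and let $p_1,\dots,p_n,q,q_1,\dots,q_n$ be pairwise distinct propositional variables. \begin{itemize} \item Every $\mathrm{PL}(\Sigma)$-formula that defines (is equivalent to) the dependence atom $=\!\!(p_1\cdots p_n;q)$ has length at least $2^n$. \item Every $\mathrm{PL}(\Sigma)$-formula that defines (is equivalent to) the exclusion atom $p_1\cdots p_n\mid q_1\cdots q_n$ has length at least $2^n$. \end{itemize}
   Context: A domain $\Phi$ is a finite set of propositional variables; a $\Phi$-assignment is a map $s:\Phi\to\{0,1\}$; a $\Phi$-team is a (possibly empty) set of $\Phi$-assignments. A split of a team $T$ is a pair $(T_1,T_2)$ with $T_1,T_2\subseteq T$ and $T_1\cup T_2=T$; it is strict if $T_1\cap T_2=\emptyset$. $\mathrm{PL}(\Sigma)$ is the set of formulas built from the literals $\top,\bot,{\sim}\top,{\sim}\bot,p,\neg p,{\sim}p,{\sim}\neg p$ by the connectives in $\Sigma$. Semantics on a team $T$: $T\models\top$ always; $T\models\bot$ iff $T=\emptyset$; $T\models p$ iff $s(p)=1$ for all $s\in T$; $T\models\neg p$ iff $s(p)=0$ for all $s\in T$; $T\models{\sim}\psi$ iff $T\not\models\psi$; $\wedge$ is conjunction; $T\models\psi\veebar\theta$ iff $T\models\psi$ or $T\models\theta$; $T\models\psi\vee\theta$ iff some split $(S,U)$ of $T$ has $S\models\psi$, $U\models\theta$; $T\models\psi\mathbin{\dot\vee}\theta$ iff some strict split does. Two formulas are equivalent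 if they are satisfied by the same teams for every domain containing all their variables. Length of a formula = its length as a string, each variable counting as one symbol. Atoms: $T\models\,=\!\!(\vec p;q)$ iff for all $s,s'\in T$, $s(\vec p)=s'(\vec p)$ implies $s(q)=s'(q)$; $T\models\vec p\mid\vec q$ iff $s(\vec p)\neq s'(\vec q)$ for all $s,s'\in T$. *)

theory Defs
  imports Main "HOL-Library.FuncSet"
begin

text \<open>A \<open>\<Phi>\<close>-assignment is an extensional function on \<open>\<Phi>\<close>, so that distinct elements of a
  \<open>\<Phi>\<close>-team differ on \<open>\<Phi>\<close>.  This matters for strict splits.\<close>

definition assignments :: "'v set \<Rightarrow> ('v \<Rightarrow> bool) set" where
  "assignments \<Phi> = \<Phi> \<rightarrow>\<^sub>E (UNIV :: bool set)"

definition is_team :: "'v set \<Rightarrow> ('v \<Rightarrow> bool) set \<Rightarrow> bool" where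
  "is_team \<Phi> T \<longleftrightarrow> T \<subseteq> assignments \<Phi>"

definition is_split :: "'a set \<Rightarrow> 'a set \<Rightarrow> 'a set \<Rightarrow> bool" where
  "is_split T T1 T2 \<longleftrightarrow> T1 \<subseteq> T \<and> T2 \<subseteq> T \<and> T1 \<union> T2 = T"

definition is_strict_split :: "'a set \<Rightarrow> 'a set \<Rightarrow> 'a set \<Rightarrow> bool" where
  "is_strict_split T T1 T2 \<longleftrightarrow> is_split T T1 T2 \<and> T1 \<inter> T2 = {}"

datatype connective = BoolDisj | Conj | SplitDisj | StrictSplitDisj

text \<open>\<open>Sim\<close> is the negation \<open>\<sim>\<close>, \<open>NVar p\<close> is the literal \<open>\<not>p\<close>.  \<open>Dep\<close> and \<open>Excl\<close> are the dependence
  and exclusion atoms.  The type is larger than any of the sets \<open>PL \<Sigma>\<close> below: these contain neither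
  the two atoms nor \<open>Sim\<close> outside of literals.\<close>

datatype 'v fm =
    Top
  | Bot
  | Var 'v
  | NVar 'v
  | Sim "'v fm"
  | Bin connective "'v fm" "'v fm"
  | Dep "'v list" 'v
  | Excl "'v list" "'v list"

inductive_set literals :: "'v fm set" where
  "Top \<in> literals"
| "Bot \<in> literals"
| "Sim Top \<in> literals"
| "Sim Bot \<in> literals"
| "Var p \<in> literals"
| "NVar p \<in> literals"
| "Sim (Var p) \<in> literals"
| "Sim (NVar p) \<in> literals"

inductive_set PL :: "connective set \<Rightarrow> 'v fm set" for \<Sigma> :: "connective set" where
  lit: "\<phi> \<in> literals \<Longrightarrow> \<phi> \<in> PL \<Sigma>"
| bin: "c \<in> \<Sigma> \<Longrightarrow> \<phi> \<in> PL \<Sigma> \<Longrightarrow> \<psi> \<in> PL \<Sigma> \<Longrightarrow> Bin c \<phi> \<psi> \<in> PL \<Sigma>"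

fun vars :: "'v fm \<Rightarrow> 'v set" where
  "vars Top = {}"
| "vars Bot = {}"
| "vars (Var p) = {p}"
| "vars (NVar p) = {p}"
| "vars (Sim \<phi>) = vars \<phi>"
| "vars (Bin c \<phi> \<psi>) = vars \<phi> \<union> vars \<psi>"
| "vars (Dep ps q) = insert q (set ps)"
| "vars (Excl ps qs) = set ps \<union> set qs"

fun sat :: "('v \<Rightarrow> bool) set \<Rightarrow> 'v fm \<Rightarrow> bool" where
  "sat T Top \<longleftrightarrow> True"
| "sat T Bot \<longleftrightarrow> T = {}"
| "sat T (Var p) \<longleftrightarrow> (\<forall>s\<in>T. s p)"
| "sat T (NVar p) \<longleftrightarrow> (\<forall>s\<in>T. \<not> s p)"
| "sat T (Sim \<phi>) \<longleftrightarrow> \<not> sat T \<phi>"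
| "sat T (Bin Conj \<phi> \<psi>) \<longleftrightarrow> sat T \<phi> \<and> sat T \<psi>"
| "sat T (Bin BoolDisj \<phi> \<psi>) \<longleftrightarrow> sat T \<phi> \<or> sat T \<psi>"
| "sat T (Bin SplitDisj \<phi> \<psi>) \<longleftrightarrow> (\<exists>S U. is_split T S U \<and> sat S \<phi> \<and> sat U \<psi>)"
| "sat T (Bin StrictSplitDisj \<phi> \<psi>) \<longleftrightarrow> (\<exists>S U. is_strict_split T S U \<and> sat S \<phi> \<and> sat U \<psi>)"
| "sat T (Dep ps q) \<longleftrightarrow> (\<forall>s\<in>T. \<forall>s'\<in>T. map s ps = map s' ps \<longrightarrow> s q = s' q)"
| "sat T (Excl ps qs) \<longleftrightarrow> (\<forall>s\<in>T. \<forall>s'\<in>T. map s ps \<noteq> map s' qs)"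

definition equivalent :: "'v fm \<Rightarrow> 'v fm \<Rightarrow> bool" where
  "equivalent \<phi> \<psi> \<longleftrightarrow>
    (\<forall>\<Phi> T. finite \<Phi> \<longrightarrow> vars \<phi> \<union> vars \<psi> \<subseteq> \<Phi> \<longrightarrow> is_team \<Phi> T \<longrightarrow> sat T \<phi> = sat T \<psi>)"

text \<open>String length, without parentheses for binary connectives (equivalently, the length of the
  formula in Polish notation).  Since parentheses only make a formula longer, a lower bound on this
  length also holds under every convention on placing and counting parentheses.\<close>

fun fm_length :: "'v fm \<Rightarrow> nat" where
  "fm_length Top = 1"
| "fm_length Bot = 1"
| "fm_length (Var p) = 1"
| "fm_length (NVar p) = 2"
| "fm_length (Sim \<phi>) = 1 + fm_length \<phi>"
| "fm_length (Bin c \<phi> \<psi>) = fm_length \<phi> + 1 + fm_length \<psi>"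
| "fm_length (Dep ps q) = length ps + 5"
| "fm_length (Excl ps qs) = length ps + 1 + length qs"

end

theory Submission imports Defs begin

text \<open>Fix a team satisfying \<open>\<phi>\<close> together with a witnessing evaluation of \<open>\<phi>\<close>. Each occurrence of a
  subformula is evaluated on exactly one team, so the evaluation resolves each occurrence of
  \<open>BoolDisj\<close> to one of its sides. Replace the upward closed literals of the resolved
  formula by \<open>Top\<close> and read it classically: every assignment that satisfies it can be added to the
  team without falsifying \<open>\<phi>\<close>. Hence a maximal team of \<open>\<phi>\<close> is the set of models of a resolution.
  A formula has at most \<open>2 ^ k\<close> resolutions, where \<open>k\<close> is the number of occurrences of \<open>BoolDisj\<close>,
  whereas the dependence atom has at least \<open>2 ^ 2 ^ n\<close> maximal teams (the graphs of the Boolean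
  functions) and the exclusion atom at least \<open>2 ^ 2 ^ n - 2\<close> (one for each nontrivial set of
  values of \<open>ps\<close>).\<close>

section \<open>Resolutions of a formula and their number\<close>

text \<open>A resolution is recorded by its models among all functions, so one family serves every
  domain. In \<open>PL\<close> formulas \<open>Sim\<close> occurs only in literals; these are upward
  closed, hence \<open>UNIV\<close>.\<close>

fun resolutions :: "'v fm \<Rightarrow> ('v \<Rightarrow> bool) set set" where
  "resolutions Top = {UNIV}"
| "resolutions Bot = {{}}"
| "resolutions (Var p) = {{s. s p}}"
| "resolutions (NVar p) = {{s. \<not> s p}}"
| "resolutions (Sim \<phi>) = {UNIV}"
| "resolutions (Bin Conj \<phi> \<psi>) = (\<lambda>(A, B). A \<inter> B) ` (resolutions \<phi> \<times> resolutions \<psi>)"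
| "resolutions (Bin BoolDisj \<phi> \<psi>) = resolutions \<phi> \<union> resolutions \<psi>"
| "resolutions (Bin SplitDisj \<phi> \<psi>) = (\<lambda>(A, B). A \<union> B) ` (resolutions \<phi> \<times> resolutions \<psi>)"
| "resolutions (Bin StrictSplitDisj \<phi> \<psi>) = (\<lambda>(A, B). A \<union> B) ` (resolutions \<phi> \<times> resolutions \<psi>)"
| "resolutions (Dep ps q) = {}"
| "resolutions (Excl ps qs) = {}"

lemma finite_resolutions: "finite (resolutions \<phi>)"
  by (induction \<phi> rule: resolutions.induct) auto

text \<open>The symbol of the connective pays for the sum at \<open>BoolDisj\<close>:
  \<open>2 ^ a + 2 ^ b \<le> 2 * 2 ^ (a + b)\<close>. The factor 2 comes from the leaves (at most
  one resolution, length at least 1); it later absorbs the two sets lost for the exclusion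
  atom.\<close>

lemma card_resolutions_le: "2 * card (resolutions \<phi>) \<le> 2 ^ fm_length \<phi>"
proof -
  have pair: "2 * card (f ` (A \<times> B)) \<le> 2 ^ (a + 1 + b)"
    if "2 * card A \<le> 2 ^ a" "2 * card B \<le> 2 ^ b" "finite A" "finite B"
    for f :: "('v \<Rightarrow> bool) set \<times> ('v \<Rightarrow> bool) set \<Rightarrow> ('v \<Rightarrow> bool) set" and A B and a b :: nat
  proof -
    have "card (f ` (A \<times> B)) \<le> card A * card B"
      using card_image_le[of "A \<times> B" f] that by (simp add: card_cartesian_product)
    moreover have "(2 * card A) * (2 * card B) \<le> 2 ^ a * 2 ^ b"
      using that by (intro mult_mono) auto
    ultimately show ?thesis by (simp add: power_add)
  qed
  have union: "2 * card (A \<union> B) \<le> 2 ^ (a + 1 + b)"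
    if "2 * card A \<le> 2 ^ a" "2 * card B \<le> 2 ^ b"
    for A B :: "('v \<Rightarrow> bool) set set" and a b :: nat
  proof -
    have "(2::nat) ^ a \<le> 2 ^ (a + b)" "(2::nat) ^ b \<le> 2 ^ (a + b)"
      by (intro power_increasing; simp)+
    moreover have "2 * card (A \<union> B) \<le> 2 ^ a + 2 ^ b"
      using card_Un_le[of A B] that by linarith
    ultimately have "2 * card (A \<union> B) \<le> 2 * 2 ^ (a + b)" by linarith
    then show ?thesis by simp
  qed
  show ?thesis
    by (induction \<phi> rule: resolutions.induct)
      (simp_all only: resolutions.simps fm_length.simps pair union finite_resolutions, simp_all)
qed

text \<open>The induction has to cover all teams between \<open>T\<close> and \<open>A\<close>: at
  \<open>Conj\<close> the set \<open>A \<inter> B\<close> can be smaller than both sides, and in a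
  strict split a side may receive only part of its resolution.\<close>

lemma sat_resolution:
  assumes "\<phi> \<in> PL \<Sigma>" and "sat T \<phi>"
  shows "\<exists>A \<in> resolutions \<phi>. T \<subseteq> A \<and> (\<forall>S. T \<subseteq> S \<longrightarrow> S \<subseteq> A \<longrightarrow> sat S \<phi>)"
  using assms
proof (induction arbitrary: T rule: PL.induct)
  case (lit \<phi>)
  then show ?case
  proof (cases rule: literals.cases)
    case (7 p)
    with lit.prems obtain s where "s \<in> T" "\<not> s p" by auto
    then have "\<exists>s\<in>S. \<not> s p" if "T \<subseteq> S" for S by (intro bexI[of _ s]) (use that in auto)
    then show ?thesis using 7 by simp
  next
    case (8 p)
    with lit.prems obtain s where "s \<in> T" "s p" by auto
    then have "\<exists>s\<in>S. s p" if "T \<subseteq> S" for S by (intro bexI[of _ s]) (use that in auto)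
    then show ?thesis using 8 by simp
  qed auto
next
  case (bin c \<phi> \<psi>)
  show ?case
  proof (cases c)
    case BoolDisj
    with bin.prems consider "sat T \<phi>" | "sat T \<psi>" by auto
    then show ?thesis
    proof cases
      case 1
      obtain A where "A \<in> resolutions \<phi>" "T \<subseteq> A" "\<And>S. T \<subseteq> S \<Longrightarrow> S \<subseteq> A \<Longrightarrow> sat S \<phi>"
        using bin.IH(1)[OF 1] by blast
      then show ?thesis using BoolDisj by (intro bexI[of _ A]) simp_all
    next
      case 2
      obtain A where "A \<in> resolutions \<psi>" "T \<subseteq> A" "\<And>S. T \<subseteq> S \<Longrightarrow> S \<subseteq> A \<Longrightarrow> sat S \<psi>"
        using bin.IH(2)[OF 2] by blast
      then show ?thesis using BoolDisj by (intro bexI[of _ A]) simp_all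
    qed
  next
    case Conj
    with bin.prems have T: "sat T \<phi>" "sat T \<psi>" by auto
    obtain A B where "A \<in> resolutions \<phi>" "T \<subseteq> A" "\<And>S. T \<subseteq> S \<Longrightarrow> S \<subseteq> A \<Longrightarrow> sat S \<phi>"
      "B \<in> resolutions \<psi>" "T \<subseteq> B" "\<And>S. T \<subseteq> S \<Longrightarrow> S \<subseteq> B \<Longrightarrow> sat S \<psi>"
      using bin.IH(1)[OF T(1)] bin.IH(2)[OF T(2)] by blast
    then show ?thesis using Conj by (intro bexI[of _ "A \<inter> B"]) auto
  next
    case SplitDisj
    with bin.prems obtain T1 T2 where T: "T = T1 \<union> T2" "sat T1 \<phi>" "sat T2 \<psi>"
      by (auto simp: is_split_def)
    obtain A B where A: "A \<in> resolutions \<phi>" "T1 \<subseteq> A" "\<And>S. T1 \<subseteq> S \<Longrightarrow> S \<subseteq> A \<Longrightarrow> sat S \<phi>"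
      and B: "B \<in> resolutions \<psi>" "T2 \<subseteq> B" "\<And>S. T2 \<subseteq> S \<Longrightarrow> S \<subseteq> B \<Longrightarrow> sat S \<psi>"
      using bin.IH(1)[OF T(2)] bin.IH(2)[OF T(3)] by blast
    have "sat S (Bin c \<phi> \<psi>)" if "T \<subseteq> S" "S \<subseteq> A \<union> B" for S
    proof -
      \<comment> \<open>Overlap is allowed, so each side takes all of \<open>S\<close> that its
        resolution admits.\<close>
      have "sat (S \<inter> A) \<phi>" "sat (S \<inter> B) \<psi>" using that A B T by auto
      moreover have "is_split S (S \<inter> A) (S \<inter> B)" using that by (auto simp: is_split_def)
      ultimately show ?thesis using SplitDisj by auto
    qed
    then show ?thesis using A(1,2) B(1,2) T(1) SplitDisj
      by (intro bexI[of _ "A \<union> B"]) auto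
  next
    case StrictSplitDisj
    with bin.prems obtain T1 T2 where T: "T = T1 \<union> T2" "T1 \<inter> T2 = {}" "sat T1 \<phi>" "sat T2 \<psi>"
      by (auto simp: is_strict_split_def is_split_def)
    obtain A B where A: "A \<in> resolutions \<phi>" "T1 \<subseteq> A" "\<And>S. T1 \<subseteq> S \<Longrightarrow> S \<subseteq> A \<Longrightarrow> sat S \<phi>"
      and B: "B \<in> resolutions \<psi>" "T2 \<subseteq> B" "\<And>S. T2 \<subseteq> S \<Longrightarrow> S \<subseteq> B \<Longrightarrow> sat S \<psi>"
      using bin.IH(1)[OF T(3)] bin.IH(2)[OF T(4)] by blast
    have "sat S (Bin c \<phi> \<psi>)" if "T \<subseteq> S" "S \<subseteq> A \<union> B" for S
    proof -
      \<comment> \<open>Removing \<open>T2\<close> keeps it on the right; \<open>T1\<close> stays on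
        the left, being disjoint from \<open>T2\<close>. The rest of \<open>S\<close> lies in
        \<open>T2\<close> or outside \<open>A\<close>, hence in \<open>B\<close>.\<close>
      define S1 where "S1 = S \<inter> A - T2"
      define S2 where "S2 = S - S1"
      have "sat S1 \<phi>" by (rule A(3)) (use that A(2) T in \<open>auto simp: S1_def\<close>)
      moreover have "sat S2 \<psi>"
        by (rule B(3)) (use that B(2) T in \<open>auto simp: S1_def S2_def\<close>)
      moreover have "is_strict_split S S1 S2"
        by (auto simp: is_strict_split_def is_split_def S1_def S2_def)
      ultimately show ?thesis using StrictSplitDisj by auto
    qed
    then show ?thesis using A(1,2) B(1,2) T(1) StrictSplitDisj
      by (intro bexI[of _ "A \<union> B"]) auto
  qed
qed

section \<open>Maximal teams and the counting bound\<close>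

definition maximal_teams :: "'v set \<Rightarrow> 'v fm \<Rightarrow> ('v \<Rightarrow> bool) set set" where
  "maximal_teams \<Phi> \<psi> = {T. is_team \<Phi> T \<and> sat T \<psi> \<and>
     (\<forall>S. is_team \<Phi> S \<longrightarrow> T \<subseteq> S \<longrightarrow> sat S \<psi> \<longrightarrow> S = T)}"

text \<open>The trace on the domain of the resolution \<open>A\<close> obtained from a maximal
  \<open>T\<close> is a team between \<open>T\<close> and \<open>A\<close>. It satisfies \<phi>,
  hence \<psi>, so maximality forces it to be \<open>T\<close>.\<close>

lemma maximal_teams_subset_resolutions:
  assumes "\<phi> \<in> PL \<Sigma>" and "equivalent \<phi> \<psi>" and "finite \<Phi>" and "vars \<phi> \<union> vars \<psi> \<subseteq> \<Phi>"
  shows "maximal_teams \<Phi> \<psi> \<subseteq> (\<lambda>A. A \<inter> assignments \<Phi>) ` resolutions \<phi>"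
proof
  fix T assume T: "T \<in> maximal_teams \<Phi> \<psi>"
  have eq: "sat S \<phi> = sat S \<psi>" if "is_team \<Phi> S" for S
    using assms that by (simp add: equivalent_def)
  obtain A where A: "A \<in> resolutions \<phi>" "T \<subseteq> A" "\<And>S. T \<subseteq> S \<Longrightarrow> S \<subseteq> A \<Longrightarrow> sat S \<phi>"
    using sat_resolution[OF assms(1), of T] T eq by (auto simp: maximal_teams_def)
  have team: "is_team \<Phi> (A \<inter> assignments \<Phi>)" and sub: "T \<subseteq> A \<inter> assignments \<Phi>"
    using T A(2) by (auto simp: maximal_teams_def is_team_def)
  have "A \<inter> assignments \<Phi> = T"
    using T team sub A(3)[OF sub] eq[OF team] by (auto simp: maximal_teams_def)
  then show "T \<in> (\<lambda>A. A \<inter> assignments \<Phi>) ` resolutions \<phi>" using A(1) by blast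
qed

text \<open>Reduces each lower bound to an injective family of maximal teams of the atom.\<close>

lemma card_le_if_inj_maximal_teams:
  assumes "\<phi> \<in> PL \<Sigma>" and "equivalent \<phi> \<psi>" and "finite \<Phi>" and "vars \<phi> \<union> vars \<psi> \<subseteq> \<Phi>"
    and "inj_on f I" and "f ` I \<subseteq> maximal_teams \<Phi> \<psi>"
  shows "2 * card I \<le> 2 ^ fm_length \<phi>"
proof -
  have "card I = card (f ` I)" using assms(5) by (simp add: card_image)
  also have "\<dots> \<le> card ((\<lambda>A. A \<inter> assignments \<Phi>) ` resolutions \<phi>)"
    using maximal_teams_subset_resolutions[OF assms(1-4)] assms(6)
    by (intro card_mono) (auto simp: finite_resolutions)
  also have "\<dots> \<le> card (resolutions \<phi>)" by (simp add: card_image_le finite_resolutions)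
  finally show ?thesis using card_resolutions_le[of \<phi>] by linarith
qed

section \<open>Families of maximal teams for the two atoms\<close>

lemma finite_vars: "finite (vars \<phi>)"
  by (induction \<phi>) auto

lemma ex_assignment_map_eq:
  assumes "distinct vs" and "length xs = length vs" and "set vs \<subseteq> \<Phi>"
  shows "\<exists>s \<in> assignments \<Phi>. map s vs = xs"
proof
  \<comment> \<open>\<open>restrict\<close> makes the function extensional; variables of \<Phi>
    outside \<open>vs\<close> get the unspecified value \<open>the None\<close>.\<close>
  let ?s = "restrict (the \<circ> map_of (zip vs xs)) \<Phi>"
  show "?s \<in> assignments \<Phi>" by (simp add: assignments_def)
  show "map ?s vs = xs"
    using assms by (auto intro!: nth_equalityI simp: map_of_zip_nth subset_iff)
qed

lemma fm_length_Dep_ge: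
  assumes "distinct (ps @ [q])" and "\<phi> \<in> PL \<Sigma>" and "equivalent \<phi> (Dep ps q)"
  shows "2 ^ length ps \<le> fm_length \<phi>"
proof -
  define \<Phi> where "\<Phi> = vars \<phi> \<union> vars (Dep ps q)"
  define L where "L = {xs :: bool list. length xs = length ps}"
  \<comment> \<open>The graph of the indicator function of \<open>X\<close>, with the other
    variables of \<Phi> left free. \<open>X\<close> is recovered as the set of values of
    \<open>ps\<close> where \<open>q\<close> holds.\<close>
  define f where "f X = {s \<in> assignments \<Phi>. s q \<longleftrightarrow> map s ps \<in> X}" for X
  have ex: "\<exists>s \<in> assignments \<Phi>. map s ps = xs \<and> s q = b" if "xs \<in> L" for xs b
    using ex_assignment_map_eq[of "ps @ [q]" "xs @ [b]" \<Phi>] that assms(1)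
    by (auto simp: L_def \<Phi>_def)
  have "inj_on f (Pow L)"
  proof (rule inj_on_inverseI)
    fix X assume "X \<in> Pow L"
    have "xs \<in> (\<lambda>s. map s ps) ` {s \<in> f X. s q}" if xs: "xs \<in> X" for xs
    proof -
      obtain s where "s \<in> assignments \<Phi>" "map s ps = xs" "s q"
        using ex[of xs True] xs \<open>X \<in> Pow L\<close> by blast
      then show ?thesis using xs by (intro image_eqI[of _ _ s]) (simp_all add: f_def)
    qed
    then show "(\<lambda>s. map s ps) ` {s \<in> f X. s q} = X" by (auto simp: f_def)
  qed
  moreover have "f ` Pow L \<subseteq> maximal_teams \<Phi> (Dep ps q)"
  proof clarify
    fix X assume "X \<subseteq> L"
    have "S \<subseteq> f X" if S: "is_team \<Phi> S" "f X \<subseteq> S" "sat S (Dep ps q)" for S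
    proof
      fix s assume "s \<in> S"
      \<comment> \<open>Every value of \<open>ps\<close> occurs in \<open>f X\<close>, so the
        dependence atom forces the value of \<open>q\<close> at \<open>s\<close>.\<close>
      obtain s' where s': "s' \<in> assignments \<Phi>" "map s' ps = map s ps" "s' q \<longleftrightarrow> map s ps \<in> X"
        using ex[of "map s ps" "map s ps \<in> X"] by (auto simp: L_def)
      then have "s' \<in> f X" by (simp add: f_def del: map_eq_conv)
      then have "s' \<in> S" using S(2) by blast
      then have "s q = s' q" using S(3) \<open>s \<in> S\<close> s'(2) by auto
      then show "s \<in> f X" using S(1) \<open>s \<in> S\<close> s' by (auto simp: f_def is_team_def)
    qed
    moreover have "is_team \<Phi> (f X)" "sat (f X) (Dep ps q)"
      by (auto simp: f_def is_team_def simp del: map_eq_conv)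
    ultimately show "f X \<in> maximal_teams \<Phi> (Dep ps q)"
      unfolding maximal_teams_def by blast
  qed
  ultimately have "2 * card (Pow L) \<le> 2 ^ fm_length \<phi>"
    by (intro card_le_if_inj_maximal_teams[OF assms(2,3), of \<Phi>]) (auto simp: \<Phi>_def finite_vars)
  moreover have "finite L" "card L = 2 ^ length ps"
    using card_lists_length_eq[of "UNIV :: bool set"] finite_lists_length_eq[of "UNIV :: bool set"]
    by (auto simp: L_def)
  ultimately have "(2::nat) ^ (2 ^ length ps) \<le> 2 ^ fm_length \<phi>"
    by (auto simp: card_Pow simp del: power_increasing_iff)
  then show ?thesis by simp
qed

lemma fm_length_Excl_ge:
  assumes "distinct (ps @ qs)" and "length qs = length ps" and "ps \<noteq> []"
    and "\<phi> \<in> PL \<Sigma>" and "equivalent \<phi> (Excl ps qs)"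
  shows "2 ^ length ps \<le> fm_length \<phi>"
proof -
  define \<Phi> where "\<Phi> = vars \<phi> \<union> vars (Excl ps qs)"
  define L where "L = {xs :: bool list. length xs = length ps}"
  \<comment> \<open>\<open>X\<close> separates the values of \<open>ps\<close> from those of
    \<open>qs\<close>.\<close>
  define f where "f X = {s \<in> assignments \<Phi>. map s ps \<in> X \<and> map s qs \<notin> X}" for X
  have ex: "\<exists>s \<in> assignments \<Phi>. map s ps = xs \<and> map s qs = ys" if "xs \<in> L" "ys \<in> L" for xs ys
    using ex_assignment_map_eq[of "ps @ qs" "xs @ ys" \<Phi>] that assms(1,2)
    by (auto simp: L_def \<Phi>_def)
  have in_L: "map s ps \<in> L" "map s qs \<in> L" for s using assms(2) by (auto simp: L_def)
  \<comment> \<open>For \<open>{}\<close> and \<open>L\<close> the team \<open>f X\<close> is empty,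
    so these two are excluded. For other \<open>X\<close>, a fixed \<open>y\<close> outside
    \<open>X\<close> as value of \<open>qs\<close> lets each member of \<open>X\<close> occur as
    value of \<open>ps\<close>.\<close>
  have "inj_on f (Pow L - {{}, L})"
  proof (rule inj_on_inverseI)
    fix X assume "X \<in> Pow L - {{}, L}"
    then obtain y where "X \<subseteq> L" "y \<in> L" "y \<notin> X" by blast
    have "xs \<in> (\<lambda>s. map s ps) ` f X" if xs: "xs \<in> X" for xs
    proof -
      obtain s where "s \<in> assignments \<Phi>" "map s ps = xs" "map s qs = y"
        using ex[of xs y] xs \<open>X \<subseteq> L\<close> \<open>y \<in> L\<close> by blast
      then show ?thesis using xs \<open>y \<notin> X\<close> by (intro image_eqI[of _ _ s]) (simp_all add: f_def)
    qed
    then show "(\<lambda>s. map s ps) ` f X = X" by (auto simp: f_def)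
  qed
  moreover have "f ` (Pow L - {{}, L}) \<subseteq> maximal_teams \<Phi> (Excl ps qs)"
  proof (rule image_subsetI)
    fix X assume "X \<in> Pow L - {{}, L}"
    then obtain x y where X: "X \<subseteq> L" "x \<in> X" "y \<in> L" "y \<notin> X" by blast
    have "S \<subseteq> f X" if S: "is_team \<Phi> S" "f X \<subseteq> S" "sat S (Excl ps qs)" for S
    proof
      fix s assume "s \<in> S"
      have "map s ps \<in> X"
      proof (rule ccontr)
        assume "map s ps \<notin> X"
        \<comment> \<open>A value of \<open>ps\<close> outside \<open>X\<close> is also a value of
          \<open>qs\<close> at some member of \<open>f X\<close>, which violates exclusion in
          \<open>S\<close>; the case of \<open>qs\<close> is dual, using \<open>y\<close>.\<close>
        then obtain s' where "s' \<in> f X" "map s' qs = map s ps"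
          using ex[of x "map s ps"] X in_L[of s] by (auto simp: f_def)
        then show False using S \<open>s \<in> S\<close> by fastforce
      qed
      moreover have "map s qs \<notin> X"
      proof
        assume "map s qs \<in> X"
        then obtain s' where "s' \<in> f X" "map s' ps = map s qs"
          using ex[of "map s qs" y] X in_L[of s] by (auto simp: f_def)
        then show False using S \<open>s \<in> S\<close> by fastforce
      qed
      ultimately show "s \<in> f X" using S(1) \<open>s \<in> S\<close> by (auto simp: f_def is_team_def)
    qed
    moreover have "is_team \<Phi> (f X)" "sat (f X) (Excl ps qs)"
      by (auto simp: f_def is_team_def simp del: map_eq_conv)
    ultimately show "f X \<in> maximal_teams \<Phi> (Excl ps qs)"
      unfolding maximal_teams_def by blast
  qed
  ultimately have "2 * card (Pow L - {{}, L}) \<le> 2 ^ fm_length \<phi>"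
    by (intro card_le_if_inj_maximal_teams[OF assms(4,5), of \<Phi>]) (auto simp: \<Phi>_def finite_vars)
  moreover have L: "finite L" "card L = 2 ^ length ps"
    using card_lists_length_eq[of "UNIV :: bool set"] finite_lists_length_eq[of "UNIV :: bool set"]
    by (auto simp: L_def)
  moreover have "2 ^ 2 ^ length ps - 2 \<le> card (Pow L - {{}, L})"
    using diff_card_le_card_Diff[of "{{}, L}" "Pow L"] L card_insert_le_m1[of 2 "{L}" "{}"]
    by (simp add: card_Pow)
  ultimately have bound: "2 * (2 ^ 2 ^ length ps - 2) \<le> (2::nat) ^ fm_length \<phi>" by linarith
  \<comment> \<open>Since \<open>ps\<close> is nonempty, \<open>2 ^ 2 ^ length ps\<close> is at
    least 4, so doubling makes up for subtracting 2.\<close>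
  have "(2::nat) ^ 2 \<le> 2 ^ 2 ^ length ps"
    using assms(3) self_le_power[of "2::nat" "length ps"] by (intro power_increasing) auto
  then have "2 ^ 2 ^ length ps \<le> 2 * (2 ^ 2 ^ length ps - 2 :: nat)" by (simp add: algebra_simps)
  from order_trans[OF this bound] have "(2::nat) ^ (2 ^ length ps) \<le> 2 ^ fm_length \<phi>" .
  then show ?thesis by simp
qed

theorem theorem3p10:
  fixes n :: nat and ps qs :: "'v list" and q :: 'v
  assumes "n \<ge> 1"
    and "length ps = n" and "length qs = n"
    and "distinct (ps @ q # qs)"
  shows "(\<forall>\<phi> \<in> PL {BoolDisj, Conj, SplitDisj, StrictSplitDisj}.
            equivalent \<phi> (Dep ps q) \<longrightarrow> fm_length \<phi> \<ge> 2 ^ n) \<and>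
         (\<forall>\<phi> \<in> PL {BoolDisj, Conj, SplitDisj, StrictSplitDisj}.
            equivalent \<phi> (Excl ps qs) \<longrightarrow> fm_length \<phi> \<ge> 2 ^ n)"
proof -
  have "distinct (ps @ [q])" "distinct (ps @ qs)" "length qs = length ps" "ps \<noteq> []"
    using assms by auto
  then show ?thesis
    unfolding assms(2)[symmetric]
    by (intro conjI ballI impI fm_length_Dep_ge[of ps q] fm_length_Excl_ge[of ps qs])
qed

end
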